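(* Let $\mathcal C_m\subset\mathbb R^N$ be a cell (closed axis-aligned hyperrectangle) with base corner $\hat{\mathbf x}_{i_m}$, side-length vector $\boldsymbol\Delta$ and corner set $\hat{\mathcal X}_m$, let $\mathcal Y$ be a finite output set, let $\mathbf Z_{\hat{\mathcal X}_m}=\{z(\mathbf y_k\mid\hat{\mathbf x}_i)\}_{(\hat{\mathbf x}_i,\mathbf y_k)\in\hat{\mathcal X}_m\times\mathcal Y}$ be the perturbation probabilities at the corners, let $p(\mathbf x)$ be the prior density and $\mathcal L(\mathbf x,\mathbf y_k)$ the pointwise utility loss, with $p(\cdot)\mathcal L(\cdot,\mathbf y_k)$ integrable over $\mathcal C_m$ for each $\mathbf y_k\in\mathcal Y$. Approximate, for $\mathbf x\in\mathcal C_m$ and $\mathbf y_k\in\mathcal Y$, the perturbation probability $\Pr[\mathcal M(\mathbf x;\mathbf Z_{\hat{\mathcal X}_m})=\mathbf y_k]$ by $$\tilde z(\mathbf y_k\mid\mathbf x):=\sum_{\boldsymbol\gamma\in\{0,1\}^N}\Big(\prod_{\ell=1}^N\big((1-\gamma_\ell)\lambda^\ell_{\hat{\mathbf x}_{i_m},\mathbf x}+\gamma_\ell(1-\lambda^\ell_{\hat{\mathbf x}_{i_m},\mathbf x})\big)\Big)\,z\big(\mathbf y_k\mid\hat{\mathbf x}_{i_m}+\boldsymbol\gamma\odot\boldsymbol\Delta\big).$$ Then the expected utility loss over the cell under this approximation, $$\tilde{\mathcal L}(\mathbf Z_{\hat{\mathcal X}_m}):=\sum_{\mathbf y_k\in\mathcal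 Y}\int_{\mathcal C_m}\tilde z(\mathbf y_k\mid\mathbf x)\,p(\mathbf x)\,\mathcal L(\mathbf x,\mathbf y_k)\,\mathrm d\mathbf x,$$ is linear in $\mathbf Z_{\hat{\mathcal X}_m}$: $\tilde{\mathcal L}(\mathbf Z_{\hat{\mathcal X}_m})=\langle\tilde{\mathbf C}_{\hat{\mathcal X}_m},\mathbf Z_{\hat{\mathcal X}_m}\rangle$, where $\tilde{\mathbf C}_{\hat{\mathcal X}_m}=\{\tilde c(\hat{\mathbf x}_j,\mathbf y_k)\}_{(\hat{\mathbf x}_j,\mathbf y_k)\in\hat{\mathcal X}_m\times\mathcal Y}$ is a constant matrix (independent of $\mathbf Z_{\hat{\mathcal X}_m}$) given, for $\hat{\mathbf x}_j=\hat{\mathbf x}_{i_m}+\boldsymbol\gamma\odot\boldsymbol\Delta$, by $$\tilde c(\hat{\mathbf x}_j,\mathbf y_k)=\int_{\mathcal C_m}\prod_{\ell=1}^N\big((1-\gamma_\ell)\lambda^\ell_{\hat{\mathbf x}_{i_m},\mathbf x}+\gamma_\ell(1-\lambda^\ell_{\hat{\mathbf x}_{i_m},\mathbf x})\big)\,p(\mathbf x)\,\mathcal L(\mathbf x,\mathbf y_k)\,\mathrm d\mathbf x .$$ If the domain is discretized, so that $\mathcal C_m$ is replaced by a finite set $\mathcal X_m\subset\mathcal C_m$ of records with prior probabilities $p(\mathbf x)$, the same holds with $\int_{\mathcal C_m}\cdots\,\mathrm d\mathbf x$ replaced by $\sum_{\mathbf x\in\mathcal X_m}$ in both formulas.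
   Context: The corner set is $\hat{\mathcal X}_m=\{\hat{\mathbf x}_{i_m}+\boldsymbol\gamma\odot\boldsymbol\Delta:\boldsymbol\gamma\in\{0,1\}^N\}$, with $\hat{\mathbf x}_{i_m}=[\hat x_{i_m,1},\dots,\hat x_{i_m,N}]$ the coordinatewise minimal corner, $\boldsymbol\Delta=[\Delta_1,\dots,\Delta_N]$ with all $\Delta_\ell>0$, and $\odot$ the entrywise product. For $\mathbf x\in\mathcal C_m$, the convex coefficients are $\lambda^\ell_{\hat{\mathbf x}_{i_m},\mathbf x}=\dfrac{\hat x_{i_m,\ell}+\Delta_\ell-x_\ell}{\Delta_\ell}\in[0,1]$. $\langle A,B\rangle=\sum_{i,k}A_{i,k}B_{i,k}$ is the Frobenius inner product. $\mathcal M(\mathbf x;\mathbf Z_{\hat{\mathcal X}_m})$ denotes the randomized mechanism whose output probabilities at $\mathbf x$ are determined by interpolation from $\mathbf Z_{\hat{\mathcal X}_m}$; in this statement those probabilities are replaced by $\tilde z$. *)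

theory Defs
  imports "HOL-Probability.Probability"
begin

definition cell :: "real^'n \<Rightarrow> real^'n \<Rightarrow> (real^'n) set" where
  "cell b \<Delta> = cbox b (b + \<Delta>)"

definition binary_vectors :: "(real^'n) set" where
  "binary_vectors = {\<gamma>. \<forall>l. \<gamma> $ l \<in> {0, 1}}"

(* Multiplication on real^'n is the entrywise product. *)
definition corner :: "real^'n \<Rightarrow> real^'n \<Rightarrow> real^'n \<Rightarrow> real^'n" where
  "corner b \<Delta> \<gamma> = b + \<gamma> * \<Delta>"

definition corners :: "real^'n \<Rightarrow> real^'n \<Rightarrow> (real^'n) set" where
  "corners b \<Delta> = corner b \<Delta> ` binary_vectors"

definition convex_coeff :: "real^'n \<Rightarrow> real^'n \<Rightarrow> real^'n \<Rightarrow> 'n \<Rightarrow> real" where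
  "convex_coeff b \<Delta> x l = (b $ l + \<Delta> $ l - x $ l) / \<Delta> $ l"

definition corner_weight :: "real^'n \<Rightarrow> real^'n \<Rightarrow> real^'n \<Rightarrow> real^'n \<Rightarrow> real" where
  "corner_weight b \<Delta> \<gamma> x =
     (\<Prod>l\<in>UNIV. (1 - \<gamma> $ l) * convex_coeff b \<Delta> x l + \<gamma> $ l * (1 - convex_coeff b \<Delta> x l))"

(* Z x y stands for z(y | x).  A matrix over corners b \<Delta> and Y is a total function of which
   only the entries with row in corners b \<Delta> and column in Y are ever used. *)
definition approx_prob ::
  "real^'n \<Rightarrow> real^'n \<Rightarrow> (real^'n \<Rightarrow> 'y \<Rightarrow> real) \<Rightarrow> 'y \<Rightarrow> real^'n \<Rightarrow> real" where
  "approx_prob b \<Delta> Z y x = (\<Sum>\<gamma>\<in>binary_vectors. corner_weight b \<Delta> \<gamma> x * Z (corner b \<Delta> \<gamma>) y)"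

definition frobenius_inner ::
  "'a set \<Rightarrow> 'b set \<Rightarrow> ('a \<Rightarrow> 'b \<Rightarrow> real) \<Rightarrow> ('a \<Rightarrow> 'b \<Rightarrow> real) \<Rightarrow> real" where
  "frobenius_inner I K A B = (\<Sum>i\<in>I. \<Sum>k\<in>K. A i k * B i k)"

(* A density given on a smaller domain is understood as extended by zero. *)
definition prior_density :: "(real^'n \<Rightarrow> real) \<Rightarrow> bool" where
  "prior_density p \<longleftrightarrow> (\<forall>x. 0 \<le> p x) \<and> has_bochner_integral lebesgue p 1"

definition approx_loss ::
  "real^'n \<Rightarrow> real^'n \<Rightarrow> 'y set \<Rightarrow> (real^'n \<Rightarrow> real) \<Rightarrow> (real^'n \<Rightarrow> 'y \<Rightarrow> real)
    \<Rightarrow> (real^'n \<Rightarrow> 'y \<Rightarrow> real) \<Rightarrow> real" where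
  "approx_loss b \<Delta> Y p L Z =
     (\<Sum>y\<in>Y. LINT x:cell b \<Delta>|lebesgue. approx_prob b \<Delta> Z y x * p x * L x y)"

definition approx_loss_discrete ::
  "real^'n \<Rightarrow> real^'n \<Rightarrow> 'y set \<Rightarrow> (real^'n) set \<Rightarrow> (real^'n) pmf \<Rightarrow> (real^'n \<Rightarrow> 'y \<Rightarrow> real)
    \<Rightarrow> (real^'n \<Rightarrow> 'y \<Rightarrow> real) \<Rightarrow> real" where
  "approx_loss_discrete b \<Delta> Y X q L Z =
     (\<Sum>y\<in>Y. \<Sum>x\<in>X. approx_prob b \<Delta> Z y x * pmf q x * L x y)"

end

theory Submission
  imports Defs
begin

text \<open>For fixed \<open>x\<close> and \<open>y\<close>, \<open>approx_prob\<close> is a finite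
  linear combination of the entries of \<open>Z\<close> whose weights do not involve
  \<open>Z\<close>. Linearity of the integral, or exchange of finite sums in the discrete case,
  therefore moves the entries outside and leaves constant coefficients
  (\<open>approx_loss_eq_sum\<close>, \<open>approx_loss_discrete_eq_sum\<close>). Splitting the
  integral is legitimate because each weight is bounded on the compact cell
  (\<open>set_integrable_corner_weight_mult\<close>). The coefficients are indexed by \<gamma>, the
  matrix by corners; positive side lengths make the two indexings equivalent
  (\<open>inj_corner\<close>, \<open>corner_matrix_exists\<close>).\<close>

lemma inj_corner:
  assumes "\<And>l. \<Delta> $ l > 0"
  shows "inj (corner b \<Delta>)"
proof (rule injI)
  fix \<gamma> \<gamma>' assume "corner b \<Delta> \<gamma> = corner b \<Delta> \<gamma>'"
  then have "\<gamma> $ l * \<Delta> $ l = \<gamma>' $ l * \<Delta> $ l" for l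
    by (simp add: corner_def vec_eq_iff)
  with assms show "\<gamma> = \<gamma>'"
    by (metis less_irrefl mult_right_cancel vec_eq_iff)
qed

lemma continuous_on_corner_weight: "continuous_on S (corner_weight b \<Delta> \<gamma>)"
  \<comment> \<open>Writing the quotient as a product with the constant
    \<open>inverse (\<Delta> $ l)\<close> avoids a side condition that \<Delta> is nonzero.\<close>
  unfolding corner_weight_def convex_coeff_def divide_inverse
  by (intro continuous_intros)

text \<open>A continuous weight on a compact box is measurable and bounded, and such a factor
  preserves absolute integrability.\<close>

lemma set_integrable_corner_weight_mult:
  assumes "set_integrable lebesgue (cell b \<Delta>) f"
  shows "set_integrable lebesgue (cell b \<Delta>) (\<lambda>x. corner_weight b \<Delta> \<gamma> x * f x)"
proof (rule absolutely_integrable_bounded_measurable_product[OF bilinear_times])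
  show "corner_weight b \<Delta> \<gamma> \<in> borel_measurable (lebesgue_on (cell b \<Delta>))"
    unfolding cell_def
    by (intro continuous_imp_measurable_on_sets_lebesgue continuous_on_corner_weight) simp
  show "bounded (corner_weight b \<Delta> \<gamma> ` cell b \<Delta>)"
    unfolding cell_def
    by (intro compact_imp_bounded compact_continuous_image continuous_on_corner_weight) simp
qed (use assms in \<open>simp_all add: cell_def\<close>)

text \<open>The step common to the continuous and the discrete case: \<open>F\<close> abstracts the
  coefficient, an integral or a finite sum.\<close>

lemma corner_matrix_exists:
  fixes loss :: "(real^'n \<Rightarrow> 'y \<Rightarrow> real) \<Rightarrow> real"
  assumes "\<And>l. \<Delta> $ l > 0"
    and loss: "\<And>Z. loss Z =
      (\<Sum>y\<in>Y. \<Sum>\<gamma>\<in>binary_vectors. F \<gamma> y * Z (corner b \<Delta> \<gamma>) y)"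
  shows "\<exists>C. (\<forall>\<gamma>\<in>binary_vectors. \<forall>y\<in>Y. C (corner b \<Delta> \<gamma>) y = F \<gamma> y) \<and>
    (\<forall>Z. loss Z = frobenius_inner (corners b \<Delta>) Y C Z)"
proof (intro exI conjI ballI allI)
  \<comment> \<open>Each corner comes from exactly one \<gamma>, so \<open>inv\<close> recovers it
    and the matrix is well defined there.\<close>
  let ?C = "\<lambda>c. F (inv (corner b \<Delta>) c)"
  note inj = inj_corner[OF assms(1), where b = b]
  show C: "?C (corner b \<Delta> \<gamma>) y = F \<gamma> y" for \<gamma> y
    by (simp add: inv_f_f[OF inj])
  show "loss Z = frobenius_inner (corners b \<Delta>) Y ?C Z" for Z
    unfolding frobenius_inner_def corners_def loss
    by (simp add: sum.reindex[OF inj_on_subset[OF inj subset_UNIV]] C sum.swap[of _ Y])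
qed

text \<open>Places the entry of \<open>Z\<close> last in each summand, as a factor free of
  \<open>x\<close> that can leave an integral or sum over \<open>x\<close>.\<close>

lemma approx_prob_mult:
  "approx_prob b \<Delta> Z y x * u * v =
     (\<Sum>\<gamma>\<in>binary_vectors. corner_weight b \<Delta> \<gamma> x * u * v * Z (corner b \<Delta> \<gamma>) y)"
  by (simp add: approx_prob_def sum_distrib_left sum_distrib_right mult_ac)

lemma approx_loss_eq_sum:
  assumes "\<And>y. y \<in> Y \<Longrightarrow> set_integrable lebesgue (cell b \<Delta>) (\<lambda>x. p x * L x y)"
  shows "approx_loss b \<Delta> Y p L Z =
    (\<Sum>y\<in>Y. \<Sum>\<gamma>\<in>binary_vectors.
       (LINT x:cell b \<Delta>|lebesgue. corner_weight b \<Delta> \<gamma> x * p x * L x y) * Z (corner b \<Delta> \<gamma>) y)"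
  unfolding approx_loss_def
proof (rule sum.cong[OF refl])
  fix y assume "y \<in> Y"
  \<comment> \<open>The Bochner integral is additive only over integrable summands, so each \<gamma>
    is treated separately.\<close>
  then have int: "set_integrable lebesgue (cell b \<Delta>)
      (\<lambda>x. corner_weight b \<Delta> \<gamma> x * p x * L x y * Z (corner b \<Delta> \<gamma>) y)" for \<gamma>
    using set_integrable_corner_weight_mult[OF assms, of y \<gamma>]
    by (intro set_integrable_mult_left) (simp add: mult.assoc)
  show "(LINT x:cell b \<Delta>|lebesgue. approx_prob b \<Delta> Z y x * p x * L x y) =
    (\<Sum>\<gamma>\<in>binary_vectors.
       (LINT x:cell b \<Delta>|lebesgue. corner_weight b \<Delta> \<gamma> x * p x * L x y) * Z (corner b \<Delta> \<gamma>) y)"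
    unfolding approx_prob_mult set_integral_mult_left[symmetric]
    using int unfolding set_lebesgue_integral_def set_integrable_def
    by (simp add: sum_distrib_left Bochner_Integration.integral_sum)
qed

lemma approx_loss_discrete_eq_sum:
  "approx_loss_discrete b \<Delta> Y X q L Z =
    (\<Sum>y\<in>Y. \<Sum>\<gamma>\<in>binary_vectors.
       (\<Sum>x\<in>X. corner_weight b \<Delta> \<gamma> x * pmf q x * L x y) * Z (corner b \<Delta> \<gamma>) y)"
  unfolding approx_loss_discrete_def approx_prob_mult
  by (simp add: sum_distrib_right sum.swap[of _ X])

theorem proposition4:
  fixes b \<Delta> :: "real^'n"
    and Y :: "'y set"
    and L :: "real^'n \<Rightarrow> 'y \<Rightarrow> real"
  assumes "\<And>l. \<Delta> $ l > 0"
    and "finite Y"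
  shows "(\<forall>p :: real^'n \<Rightarrow> real.
            prior_density p \<and>
            (\<forall>y\<in>Y. set_integrable lebesgue (cell b \<Delta>) (\<lambda>x. p x * L x y)) \<longrightarrow>
            (\<exists>C. (\<forall>\<gamma>\<in>binary_vectors. \<forall>y\<in>Y.
                    C (corner b \<Delta> \<gamma>) y =
                      (LINT x:cell b \<Delta>|lebesgue. corner_weight b \<Delta> \<gamma> x * p x * L x y)) \<and>
                 (\<forall>Z. approx_loss b \<Delta> Y p L Z = frobenius_inner (corners b \<Delta>) Y C Z))) \<and>
         (\<forall>(q :: (real^'n) pmf) X.
            finite X \<and> X \<subseteq> cell b \<Delta> \<longrightarrow>
            (\<exists>C. (\<forall>\<gamma>\<in>binary_vectors. \<forall>y\<in>Y.
                    C (corner b \<Delta> \<gamma>) y = (\<Sum>x\<in>X. corner_weight b \<Delta> \<gamma> x * pmf q x * L x y)) \<and>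
                 (\<forall>Z. approx_loss_discrete b \<Delta> Y X q L Z =
                       frobenius_inner (corners b \<Delta>) Y C Z)))"
proof (intro conjI allI impI, goal_cases)
  case (1 p)
  then have "set_integrable lebesgue (cell b \<Delta>) (\<lambda>x. p x * L x y)" if "y \<in> Y" for y
    using that by blast
  then show ?case
    \<comment> \<open>Unification with the goal supplies \<open>F\<close>; the expansion of the loss
      is then the premise to discharge.\<close>
    by (intro corner_matrix_exists assms(1) approx_loss_eq_sum)
next
  case (2 q X)
  show ?case
    by (intro corner_matrix_exists assms(1) approx_loss_discrete_eq_sum)
qed

end
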